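(* Among all configurations $P=\{p_1,\dots,p_5\}$ of $5$ distinct points on the unit sphere $S^2\subset\mathbb{R}^3$, the triangular bi-pyramid is the unique configuration (up to isometries of $S^2$) of minimal energy with respect to the $1/r^2$ potential, i.e. the unique minimizer of $$\mathcal{E}(P)=\sum_{i>j}\frac{1}{\|p_i-p_j\|^2}.$$
   Context: $\|\cdot\|$ is the Euclidean norm on $\mathbb{R}^3$. The triangular bi-pyramid (TBP) is the configuration of $5$ points on $S^2$ in which two points are antipodal and the remaining three points form an equilateral triangle on the equator midway between the two antipodal points. It is well defined up to isometries of $S^2$. *)

theory Defs
  imports "HOL-Analysis.Analysis"
begin

abbreviation S2 :: "(real ^ 3) set" where
  "S2 \<equiv> sphere 0 1"

text \<open>A configuration is labelled by the indices 1 to 5, so that the energy is literally a sum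
  over \<open>i > j\<close>; the values of \<open>p\<close> outside these indices are irrelevant. The unlabelled
  configuration is \<open>points p\<close>.\<close>

definition points :: "(nat \<Rightarrow> real ^ 3) \<Rightarrow> (real ^ 3) set" where
  "points p = p ` {1..5}"

definition configuration :: "(nat \<Rightarrow> real ^ 3) \<Rightarrow> bool" where
  "configuration p \<longleftrightarrow> inj_on p {1..5} \<and> points p \<subseteq> S2"

definition energy :: "(nat \<Rightarrow> real ^ 3) \<Rightarrow> real" where
  "energy p = (\<Sum>i\<in>{1..5}. \<Sum>j\<in>{1..<i}. 1 / norm (p i - p j) ^ 2)"

definition energy_minimizer :: "(nat \<Rightarrow> real ^ 3) \<Rightarrow> bool" where
  "energy_minimizer p \<longleftrightarrow>
     configuration p \<and> (\<forall>q. configuration q \<longrightarrow> energy p \<le> energy q)"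

text \<open>The poles are \<open>a\<close> and \<open>-a\<close>, and the equator midway between them is the set of points of
  the sphere orthogonal to \<open>a\<close>. The condition \<open>u \<noteq> v\<close> excludes the degenerate triangle.\<close>

definition triangular_bipyramid :: "(real ^ 3) set \<Rightarrow> bool" where
  "triangular_bipyramid P \<longleftrightarrow>
     (\<exists>a u v w. P = {a, -a, u, v, w} \<and> a \<in> S2 \<and>
        {u, v, w} \<subseteq> {x \<in> S2. a \<bullet> x = 0} \<and>
        u \<noteq> v \<and> dist u v = dist v w \<and> dist v w = dist w u)"

text \<open>The chordal distance is used; it is a strictly increasing function of the geodesic distance
  on the sphere, so both have the same isometries.\<close>

definition S2_isometry :: "(real ^ 3 \<Rightarrow> real ^ 3) \<Rightarrow> bool" where
  "S2_isometry f \<longleftrightarrow>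
     bij_betw f S2 S2 \<and> (\<forall>x\<in>S2. \<forall>y\<in>S2. dist (f x) (f y) = dist x y)"

end

theory Submission
  imports Defs
begin

text \<open>Write \<open>f t = 1 / (2 - 2 * t)\<close>, so that two points of the sphere with inner product \<open>t\<close>
  contribute \<open>f t\<close>. Let \<open>a\<close>, \<open>b\<close> be the two points with the smallest inner product \<open>m\<close>.

  If \<open>m > -2/3\<close>, then \<open>f\<close> lies above a parabola that touches it at \<open>0\<close> and meets it at \<open>m\<close>;
  the sum of the inner products is at least \<open>-5/2\<close> and that of their squares at least \<open>5/3\<close>,
  which gives an energy above \<open>17/4\<close>, the energy of the bi-pyramid.

  Otherwise \<open>a\<close>, \<open>b\<close> are nearly antipodal. Put \<open>(a + b) / 2 = \<mu> e\<close> and \<open>(a - b) / 2 = \<nu> k\<close> with \<open>e\<close>, \<open>k\<close>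
  orthonormal, and give the three other points coordinates \<open>(p, q, r)\<close> along \<open>e\<close>, \<open>e \<times> k\<close>, \<open>k\<close>.
  The energy between them and the poles \<open>a\<close>, \<open>b\<close> is kept, up to a Taylor estimate, while their mutual
  energy is bounded below by replacing \<open>f\<close> by the parabola that touches it at a parameter \<open>\<tau>\<close> and
  meets it at \<open>m\<close> (at \<open>-1\<close> for small \<open>\<mu>\<close>). Both parts then depend only on the sum of the \<open>p\<close> and the sums of the \<open>p\<^sup>2\<close> and \<open>r\<^sup>2\<close>,
  and completing squares leaves an inequality in the single variable \<open>\<mu>\<close>. The shift of \<open>\<tau>\<close> away from
  the value \<open>-1/2\<close> of the equilateral triangle, as \<open>\<mu>\<close> grows, is what makes it hold up to \<open>\<mu>\<^sup>2 = 1/6\<close>.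
  For \<open>\<mu> = 0\<close> the poles are antipodal and the equality case can be read off.\<close>

section \<open>Parabolas below the potential\<close>

lemma quadratic_ge_vertex:
  fixes b k x :: real
  assumes "0 < k"
  shows "- (b\<^sup>2 / (4 * k)) \<le> b * x + k * x\<^sup>2"
proof -
  have "b * x + k * x\<^sup>2 + b\<^sup>2 / (4 * k) = k * (x + b / (2 * k))\<^sup>2"
    using assms by (simp add: field_simps power2_eq_square)
  moreover have "0 \<le> k * (x + b / (2 * k))\<^sup>2"
    using assms by simp
  ultimately show ?thesis by linarith
qed

text \<open>With \<open>s = 1 - t\<close> and \<open>w = 1 - \<tau>\<close>, the potential equals
  its tangent at \<tau> plus exactly \<open>(w - s)\<^sup>2 / (2 * w\<^sup>2 * s)\<close>. The
  condition on \<kappa> says that it is at most the coefficient of \<open>(w - s)\<^sup>2\<close>;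
  with equality the parabola meets the potential at \<open>t\<close>.\<close>

lemma riesz_ge_quadratic:
  fixes t \<tau> \<kappa> :: real
  assumes "t < 1" "\<tau> < 1" and \<kappa>: "2 * \<kappa> * (1 - \<tau>)\<^sup>2 * (1 - t) \<le> 1"
  shows "1 / (2 * (1 - \<tau>)) + (t - \<tau>) / (2 * (1 - \<tau>)\<^sup>2) + \<kappa> * (t - \<tau>)\<^sup>2 \<le> 1 / (2 - 2 * t)"
proof -
  have *: "1 / (2 * s) = 1 / (2 * w) + (w - s) / (2 * w\<^sup>2) + 1 / (2 * w\<^sup>2 * s) * (w - s)\<^sup>2"
    if "s > 0" "w > 0" for s w :: real
    using that by (simp add: field_simps power2_eq_square)
  have "\<kappa> \<le> 1 / (2 * (1 - \<tau>)\<^sup>2 * (1 - t))"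
    using assms by (simp add: field_simps)
  then have "\<kappa> * (t - \<tau>)\<^sup>2 \<le> 1 / (2 * (1 - \<tau>)\<^sup>2 * (1 - t)) * (t - \<tau>)\<^sup>2"
    by (rule mult_right_mono) simp
  with *[of "1 - t" "1 - \<tau>"] assms show ?thesis by simp
qed

text \<open>With \<open>w = 1 - \<alpha>\<close> the sum is
  \<open>w / (w\<^sup>2 - \<beta>\<^sup>2)\<close>, a geometric series in
  \<open>\<beta>\<^sup>2 / w\<^sup>2\<close>. Its first two terms are kept, and \<open>w\<close> is
  replaced by \<open>1 + \<mu>\<close> in the second-order terms only. It serves for the energy of
  one point with both poles.\<close>

lemma riesz_sum_symmetric_ge:
  fixes \<alpha> \<beta> \<mu> :: real
  assumes "- \<mu> \<le> \<alpha>" and \<beta>: "\<bar>\<beta>\<bar> < 1 - \<alpha>"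
  shows "1 + \<alpha> + \<alpha>\<^sup>2 / (1 + \<mu>) + \<beta>\<^sup>2 / (1 + \<mu>) ^ 3
    \<le> 1 / (2 - 2 * (\<alpha> + \<beta>)) + 1 / (2 - 2 * (\<alpha> - \<beta>))"
proof -
  define w where "w = 1 - \<alpha>"
  have w: "0 < w" "w \<le> 1 + \<mu>" and "\<bar>\<beta>\<bar> < w"
    using assms by (auto simp: w_def)
  then have pos: "0 < w - \<beta>" "0 < w + \<beta>" by auto
  then have pos2: "0 < w\<^sup>2 - \<beta>\<^sup>2"
    using mult_pos_pos[OF pos] by (simp add: algebra_simps power2_eq_square)
  have "1 + \<alpha> + \<alpha>\<^sup>2 / (1 + \<mu>) + \<beta>\<^sup>2 / (1 + \<mu>) ^ 3 \<le> 1 + \<alpha> + \<alpha>\<^sup>2 / w + \<beta>\<^sup>2 / w ^ 3"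
    using w by (intro add_mono divide_left_mono power_mono order_refl) auto
  also have "\<dots> = 1 / w + \<beta>\<^sup>2 / w ^ 3"
    using w by (simp add: w_def field_simps power2_eq_square)
  also have "\<dots> = (w\<^sup>2 + \<beta>\<^sup>2) / w ^ 3"
    using w by (simp add: field_simps eval_nat_numeral)
  also have "\<dots> \<le> w / (w\<^sup>2 - \<beta>\<^sup>2)"
  proof -
    have "(w\<^sup>2 + \<beta>\<^sup>2) * (w\<^sup>2 - \<beta>\<^sup>2) = w ^ 4 - (\<beta>\<^sup>2)\<^sup>2" by algebra
    also have "\<dots> \<le> w * w ^ 3" by (simp add: eval_nat_numeral)
    finally show ?thesis using pos2 w by (simp add: divide_simps)
  qed
  also have "\<dots> = 1 / (2 * (w - \<beta>)) + 1 / (2 * (w + \<beta>))"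
    using pos pos2 by (simp add: divide_simps) algebra
  finally show ?thesis by (simp add: w_def algebra_simps)
qed

text \<open>\<open>\<tau>\<close> is the point of contact and \<open>\<kappa>\<close> the leading coefficient of the parabola below \<open>f\<close>; \<open>\<delta>\<close> bounds the
  rate at which the estimate can decrease when the three other points leave the plane \<open>r = 0\<close>.\<close>

definition lower_bound :: "real \<Rightarrow> real \<Rightarrow> real \<Rightarrow> real \<Rightarrow> real" where
  "lower_bound \<mu> \<tau> \<kappa> \<delta> =
     1 / (4 * (1 - \<mu>\<^sup>2)) + 3
     + (3 / (2 * (1 - \<tau>)) - (3 / 2 + 3 * \<tau>) / (2 * (1 - \<tau>)\<^sup>2) + \<kappa> * (3 / 4 + 3 * \<tau> + 3 * \<tau>\<^sup>2))
     - \<mu>\<^sup>2 / (2 * (1 / (2 * (1 - \<tau>)\<^sup>2) - 2 * \<kappa> * \<tau>))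
     + 3 / 2 * (\<mu>\<^sup>2 / (1 + \<mu>)) - (\<mu>\<^sup>2 / (1 + \<mu>))\<^sup>2 / (4 * \<kappa>) - \<delta>\<^sup>2 / (3 * \<kappa>)"

text \<open>The parabola, whose linear coefficient is \<open>B\<close>, is summed over the three
  pairs. The inner products are controlled by the squared length of the sum of the points, of which
  only the first coordinate is kept. Their squares are controlled by the Frobenius norm of the 3 by
  3 second moment matrix, of which only the diagonal \<open>P\<close>, \<open>3 - P - R\<close>,
  \<open>R\<close> is kept.\<close>

lemma triangle_energy_ge:
  fixes p1 p2 p3 q1 q2 q3 r1 r2 r3 \<tau> \<kappa> :: real
  defines "t12 \<equiv> p1 * p2 + q1 * q2 + r1 * r2"
    and "t13 \<equiv> p1 * p3 + q1 * q3 + r1 * r3"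
    and "t23 \<equiv> p2 * p3 + q2 * q3 + r2 * r3"
    and "S \<equiv> p1 + p2 + p3" and "P \<equiv> p1\<^sup>2 + p2\<^sup>2 + p3\<^sup>2" and "R \<equiv> r1\<^sup>2 + r2\<^sup>2 + r3\<^sup>2"
    and "B \<equiv> 1 / (2 * (1 - \<tau>)\<^sup>2) - 2 * \<kappa> * \<tau>"
  assumes u: "p1\<^sup>2 + q1\<^sup>2 + r1\<^sup>2 = 1" "p2\<^sup>2 + q2\<^sup>2 + r2\<^sup>2 = 1" "p3\<^sup>2 + q3\<^sup>2 + r3\<^sup>2 = 1"
    and lt: "t12 < 1" "t13 < 1" "t23 < 1"
    and ge: "m \<le> t12" "m \<le> t13" "m \<le> t23"
    and \<tau>: "\<tau> \<le> 0" and \<kappa>: "0 < \<kappa>" "2 * \<kappa> * (1 - \<tau>)\<^sup>2 * (1 - m) \<le> 1"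
  shows "3 / (2 * (1 - \<tau>)) - 3 * \<tau> / (2 * (1 - \<tau>)\<^sup>2) + 3 * \<kappa> * \<tau>\<^sup>2
      + B * ((S\<^sup>2 - 3) / 2) + \<kappa> * ((P\<^sup>2 + (3 - P - R)\<^sup>2 + R\<^sup>2 - 3) / 2)
    \<le> 1 / (2 - 2 * t12) + 1 / (2 - 2 * t13) + 1 / (2 - 2 * t23)"
proof -
  have minorant: "1 / (2 * (1 - \<tau>)) + (t - \<tau>) / (2 * (1 - \<tau>)\<^sup>2) + \<kappa> * (t - \<tau>)\<^sup>2 \<le> 1 / (2 - 2 * t)"
    if "t < 1" "m \<le> t" for t
  proof (rule riesz_ge_quadratic)
    \<comment> \<open>The factor \<open>1 - t\<close> is largest at \<open>t = m\<close>, so the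
      condition at \<open>m\<close> covers all \<open>t\<close> from \<open>m\<close> on.\<close>
    have "2 * \<kappa> * (1 - \<tau>)\<^sup>2 * (1 - t) \<le> 2 * \<kappa> * (1 - \<tau>)\<^sup>2 * (1 - m)"
      using that \<kappa> by (intro mult_left_mono) auto
    with \<kappa> show "2 * \<kappa> * (1 - \<tau>)\<^sup>2 * (1 - t) \<le> 1" by linarith
  qed (use that \<tau> in auto)
  have "2 * \<kappa> * \<tau> \<le> 0"
    using \<tau> \<kappa> by (simp add: mult_nonneg_nonpos)
  moreover have "0 < 1 / (2 * (1 - \<tau>)\<^sup>2)"
    using \<tau> by simp
  ultimately have "0 < B" unfolding B_def by linarith
  have "S\<^sup>2 - 3 \<le> S\<^sup>2 + (q1 + q2 + q3)\<^sup>2 + (r1 + r2 + r3)\<^sup>2 - 3"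
    by simp
  also have "\<dots> = 2 * (t12 + t13 + t23)"
    unfolding S_def t12_def t13_def t23_def using u by algebra
  finally have "(S\<^sup>2 - 3) / 2 \<le> t12 + t13 + t23"
    by simp
  with \<open>0 < B\<close> have 1: "B * ((S\<^sup>2 - 3) / 2) \<le> B * (t12 + t13 + t23)"
    by (intro mult_left_mono) auto
  have Q: "3 - P - R = q1\<^sup>2 + q2\<^sup>2 + q3\<^sup>2"
    using u by (simp add: P_def R_def)
  have "P\<^sup>2 + (3 - P - R)\<^sup>2 + R\<^sup>2 - 3 \<le> P\<^sup>2 + (3 - P - R)\<^sup>2 + R\<^sup>2 - 3
      + 2 * ((p1 * q1 + p2 * q2 + p3 * q3)\<^sup>2 + (p1 * r1 + p2 * r2 + p3 * r3)\<^sup>2 + (q1 * r1 + q2 * r2 + q3 * r3)\<^sup>2)"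
    by simp
  also have "\<dots> = 2 * (t12\<^sup>2 + t13\<^sup>2 + t23\<^sup>2)"
    unfolding Q unfolding P_def R_def t12_def t13_def t23_def using u by algebra
  finally have "(P\<^sup>2 + (3 - P - R)\<^sup>2 + R\<^sup>2 - 3) / 2 \<le> t12\<^sup>2 + t13\<^sup>2 + t23\<^sup>2"
    by simp
  with \<kappa> have 2: "\<kappa> * ((P\<^sup>2 + (3 - P - R)\<^sup>2 + R\<^sup>2 - 3) / 2) \<le> \<kappa> * (t12\<^sup>2 + t13\<^sup>2 + t23\<^sup>2)"
    by (intro mult_left_mono) auto
  define g where "g = 1 / (2 * (1 - \<tau>)\<^sup>2)"
  have g: "x / (2 * (1 - \<tau>)\<^sup>2) = x * g" for x by (simp add: g_def)
  have "3 / (2 * (1 - \<tau>)) - 3 * \<tau> * g + 3 * \<kappa> * \<tau>\<^sup>2 + B * (t12 + t13 + t23) + \<kappa> * (t12\<^sup>2 + t13\<^sup>2 + t23\<^sup>2)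
    = (1 / (2 * (1 - \<tau>)) + (t12 - \<tau>) * g + \<kappa> * (t12 - \<tau>)\<^sup>2)
    + (1 / (2 * (1 - \<tau>)) + (t13 - \<tau>) * g + \<kappa> * (t13 - \<tau>)\<^sup>2)
    + (1 / (2 * (1 - \<tau>)) + (t23 - \<tau>) * g + \<kappa> * (t23 - \<tau>)\<^sup>2)"
    unfolding B_def g_def[symmetric] by (simp add: algebra_simps power2_eq_square)
  with 1 2 minorant[OF lt(1) ge(1)] minorant[OF lt(2) ge(2)] minorant[OF lt(3) ge(3)]
  show ?thesis unfolding g by linarith
qed

text \<open>The pole and triangle estimates add up to a constant plus three separate quadratics, in
  \<open>S\<close>, in \<open>P + R / 2 - 3 / 2\<close> and in \<open>R\<close>; each is bounded by
  its vertex value. The number \<open>2 * \<mu>\<^sup>2 - 1\<close> is the inner product of the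
  poles.\<close>

lemma energy_ge_lower_bound:
  fixes p1 p2 p3 q1 q2 q3 r1 r2 r3 \<mu> \<nu> \<tau> \<kappa> \<delta> :: real
  defines "t12 \<equiv> p1 * p2 + q1 * q2 + r1 * r2"
    and "t13 \<equiv> p1 * p3 + q1 * q3 + r1 * r3"
    and "t23 \<equiv> p2 * p3 + q2 * q3 + r2 * r3"
  assumes u: "p1\<^sup>2 + q1\<^sup>2 + r1\<^sup>2 = 1" "p2\<^sup>2 + q2\<^sup>2 + r2\<^sup>2 = 1" "p3\<^sup>2 + q3\<^sup>2 + r3\<^sup>2 = 1"
    and lt: "t12 < 1" "t13 < 1" "t23 < 1"
    and ge: "2 * \<mu>\<^sup>2 - 1 \<le> t12" "2 * \<mu>\<^sup>2 - 1 \<le> t13" "2 * \<mu>\<^sup>2 - 1 \<le> t23"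
    and \<mu>: "0 \<le> \<mu>" "\<mu> < 1" and \<nu>: "\<nu>\<^sup>2 = 1 - \<mu>\<^sup>2"
    and pole: "\<bar>\<nu> * r1\<bar> < 1 - \<mu> * p1" "\<bar>\<nu> * r2\<bar> < 1 - \<mu> * p2" "\<bar>\<nu> * r3\<bar> < 1 - \<mu> * p3"
    and \<tau>: "\<tau> \<le> 0" and \<kappa>: "0 < \<kappa>" "4 * \<kappa> * (1 - \<tau>)\<^sup>2 * (1 - \<mu>\<^sup>2) \<le> 1"
    and \<delta>: "0 \<le> \<delta>" "\<mu>\<^sup>2 / (2 * (1 + \<mu>)) + 3 / 2 * \<kappa> - (1 - \<mu>) / (1 + \<mu>)\<^sup>2 \<le> \<delta>"
  shows "lower_bound \<mu> \<tau> \<kappa> \<delta> \<le>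
      1 / (4 * (1 - \<mu>\<^sup>2))
      + (1 / (2 - 2 * (\<mu> * p1 + \<nu> * r1)) + 1 / (2 - 2 * (\<mu> * p1 - \<nu> * r1)))
      + (1 / (2 - 2 * (\<mu> * p2 + \<nu> * r2)) + 1 / (2 - 2 * (\<mu> * p2 - \<nu> * r2)))
      + (1 / (2 - 2 * (\<mu> * p3 + \<nu> * r3)) + 1 / (2 - 2 * (\<mu> * p3 - \<nu> * r3)))
      + (1 / (2 - 2 * t12) + 1 / (2 - 2 * t13) + 1 / (2 - 2 * t23))"
proof -
  define S P R where "S = p1 + p2 + p3" and "P = p1\<^sup>2 + p2\<^sup>2 + p3\<^sup>2" and "R = r1\<^sup>2 + r2\<^sup>2 + r3\<^sup>2"
  define B where "B = 1 / (2 * (1 - \<tau>)\<^sup>2) - 2 * \<kappa> * \<tau>"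
  define c where "c = \<mu>\<^sup>2 / (1 + \<mu>)"
  define \<gamma> where "\<gamma> = (1 - \<mu>) / (1 + \<mu>)\<^sup>2"
  have "2 * \<kappa> * \<tau> \<le> 0"
    using \<tau> \<kappa> by (simp add: mult_nonneg_nonpos)
  moreover have "0 < 1 / (2 * (1 - \<tau>)\<^sup>2)"
    using \<tau> by simp
  ultimately have "0 < B" unfolding B_def by linarith
  have \<gamma>: "\<nu>\<^sup>2 / (1 + \<mu>) ^ 3 = \<gamma>"
  proof -
    have "\<nu>\<^sup>2 = (1 - \<mu>) * (1 + \<mu>)" using \<nu> by (simp add: algebra_simps power2_eq_square)
    then show ?thesis using \<mu> by (simp add: \<gamma>_def eval_nat_numeral)
  qed
  have poles: "1 + \<mu> * p + c * p\<^sup>2 + \<gamma> * r\<^sup>2 \<le> 1 / (2 - 2 * (\<mu> * p + \<nu> * r)) + 1 / (2 - 2 * (\<mu> * p - \<nu> * r))"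
    if "p\<^sup>2 + q\<^sup>2 + r\<^sup>2 = 1" "\<bar>\<nu> * r\<bar> < 1 - \<mu> * p" for p q r
  proof -
    have "p\<^sup>2 \<le> 1" using that(1) zero_le_power2[of q] zero_le_power2[of r] by linarith
    then have "- 1 \<le> p" by (simp add: power2_le_iff_abs_le abs_square_le_1)
    then have "- \<mu> \<le> \<mu> * p" using \<mu> mult_left_mono[of "-1" p \<mu>] by simp
    from riesz_sum_symmetric_ge[OF this that(2)] show ?thesis
      by (simp add: power_mult_distrib c_def flip: \<gamma>)
  qed
  have "3 + \<mu> * S + c * P + \<gamma> * R \<le>
      (1 / (2 - 2 * (\<mu> * p1 + \<nu> * r1)) + 1 / (2 - 2 * (\<mu> * p1 - \<nu> * r1)))
      + (1 / (2 - 2 * (\<mu> * p2 + \<nu> * r2)) + 1 / (2 - 2 * (\<mu> * p2 - \<nu> * r2)))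
      + (1 / (2 - 2 * (\<mu> * p3 + \<nu> * r3)) + 1 / (2 - 2 * (\<mu> * p3 - \<nu> * r3)))"
    using poles[OF u(1) pole(1)] poles[OF u(2) pole(2)] poles[OF u(3) pole(3)]
    by (simp add: S_def P_def R_def algebra_simps)
  moreover have "3 / (2 * (1 - \<tau>)) - 3 * \<tau> / (2 * (1 - \<tau>)\<^sup>2) + 3 * \<kappa> * \<tau>\<^sup>2
      + B * ((S\<^sup>2 - 3) / 2) + \<kappa> * ((P\<^sup>2 + (3 - P - R)\<^sup>2 + R\<^sup>2 - 3) / 2)
    \<le> 1 / (2 - 2 * t12) + 1 / (2 - 2 * t13) + 1 / (2 - 2 * t23)"
  proof -
    have "2 * \<kappa> * (1 - \<tau>)\<^sup>2 * (1 - (2 * \<mu>\<^sup>2 - 1)) \<le> 1"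
      using \<kappa> by (simp add: algebra_simps)
    from triangle_energy_ge[OF u _ _ _ _ _ _ \<tau> \<kappa>(1) this] lt ge show ?thesis
      unfolding S_def P_def R_def B_def t12_def t13_def t23_def by blast
  qed
  moreover have "- (\<mu>\<^sup>2 / (2 * B)) \<le> \<mu> * S + B / 2 * S\<^sup>2"
    using quadratic_ge_vertex[of "B / 2" \<mu> S] \<open>0 < B\<close> by simp
  \<comment> \<open>With \<open>Q = 3 - P - R\<close>, the variable here is
    \<open>(P - Q) / 2\<close>, which decouples \<open>P\<^sup>2 + Q\<^sup>2\<close> from
    \<open>R\<close>.\<close>
  moreover have "- (c\<^sup>2 / (4 * \<kappa>)) \<le> c * (P + R / 2 - 3 / 2) + \<kappa> * (P + R / 2 - 3 / 2)\<^sup>2"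
    using quadratic_ge_vertex \<kappa> by blast
  \<comment> \<open>Since \<open>R\<close> is nonnegative, its linear coefficient may be lowered to
    \<open>- \<delta>\<close>. For \<open>\<delta> = 0\<close> the terms in \<open>R\<close> are
    simply nonnegative.\<close>
  moreover have "- (\<delta>\<^sup>2 / (3 * \<kappa>)) \<le> (\<gamma> - c / 2 - 3 / 2 * \<kappa>) * R + 3 / 4 * \<kappa> * R\<^sup>2"
  proof -
    have \<delta>': "c / 2 + 3 / 2 * \<kappa> - \<gamma> \<le> \<delta>"
      using \<delta> by (simp add: \<gamma>_def c_def mult.commute)
    have "0 \<le> R" by (simp add: R_def)
    then have "- \<delta> * R \<le> (\<gamma> - c / 2 - 3 / 2 * \<kappa>) * R"
      using \<delta>' by (intro mult_right_mono) linarith+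
    with quadratic_ge_vertex[of "3 / 4 * \<kappa>" "- \<delta>" R] \<kappa> show ?thesis by simp
  qed
  moreover have "lower_bound \<mu> \<tau> \<kappa> \<delta> = 1 / (4 * (1 - \<mu>\<^sup>2)) + 3
      + (3 / (2 * (1 - \<tau>)) - 3 * \<tau> / (2 * (1 - \<tau>)\<^sup>2) + 3 * \<kappa> * \<tau>\<^sup>2) - 3 / 2 * B + 3 / 4 * \<kappa>
      - \<mu>\<^sup>2 / (2 * B) + 3 / 2 * c - c\<^sup>2 / (4 * \<kappa>) - \<delta>\<^sup>2 / (3 * \<kappa>)"
    unfolding lower_bound_def c_def[symmetric] B_def[symmetric]
    by (simp add: B_def add_divide_distrib algebra_simps)
  moreover have "B * ((S\<^sup>2 - 3) / 2) = B / 2 * S\<^sup>2 - 3 / 2 * B"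
    by (simp add: field_simps)
  moreover have "c * P + \<gamma> * R + \<kappa> * ((P\<^sup>2 + (3 - P - R)\<^sup>2 + R\<^sup>2 - 3) / 2)
      = (c * (P + R / 2 - 3 / 2) + \<kappa> * (P + R / 2 - 3 / 2)\<^sup>2)
        + ((\<gamma> - c / 2 - 3 / 2 * \<kappa>) * R + 3 / 4 * \<kappa> * R\<^sup>2) + 3 / 2 * c + 3 / 4 * \<kappa>"
    by (simp add: field_simps power2_eq_square)
  ultimately show ?thesis by linarith
qed

section \<open>The inequality in one variable\<close>

text \<open>The substitutions below are Taylor expansions at an endpoint of the interval.\<close>

lemma numerator_half_pos:
  fixes x :: real
  assumes "0 \<le> x" "x \<le> 4/25"
  shows "0 < 15*x^3 - 9*x^2 - 5*x + 1"
proof -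
  define s where "s = 4/25 - x"
  have s: "0 \<le> s" "s \<le> 4/25" and x: "x = 4/25 - s" using assms by (simp_all add: s_def)
  have "15*x^3 - 9*x^2 - 5*x + 1 = 97/3125 + s * (841/125 - 9/5 * s - 15 * s^2)"
    unfolding x by algebra
  moreover have "s^2 \<le> (4/25)^2" using s by (intro power_mono) auto
  then have "0 \<le> s * (841/125 - 9/5 * s - 15 * s^2)" using s
    by (intro mult_nonneg_nonneg) (auto simp: power2_eq_square)
  ultimately show ?thesis by linarith
qed

text \<open>The terms of the expansion are grouped so that in each bracket the positive constant
  outweighs the negative terms on the whole range of \<open>s\<close>.\<close>

lemma numerator_third_pos:
  fixes x :: real
  assumes "4/25 \<le> x" "x \<le> 1/4"
  shows "0 < 12288*x^8 - 24576*x^7 - 16384*x^6 + 43136*x^5 - 4012*x^4 - 13824*x^3 + 4011*x^2 - 36"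
proof -
  define s where "s = x - 4/25"
  have s: "0 \<le> s" "s \<le> 9/100" and x: "x = s + 4/25" using assms by (simp_all add: s_def)
  have "12288*x^8 - 24576*x^7 - 16384*x^6 + 43136*x^5 - 4012*x^4 - 13824*x^3 + 4011*x^2 - 36
     = 1772576624268/152587890625
       + s * (1736584350936/6103515625 - 410966324581/244140625 * s - 70142580928/9765625 * s^2)
       + s^4 * (1659831492/78125 + 265841792/15625 * s - 21938176/625 * s^2 - 221184/25 * s^3 + 12288 * s^4)"
    unfolding x by algebra
  moreover have s2: "s^2 \<le> (9/100)^2" and s3: "s^3 \<le> (9/100)^3" and "0 \<le> s^4" using s by (auto intro!: power_mono)
  have "0 \<le> s * (1736584350936/6103515625 - 410966324581/244140625 * s - 70142580928/9765625 * s^2)"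
    using s s2 by (intro mult_nonneg_nonneg) (simp_all add: power2_eq_square)
  moreover have "0 \<le> s^4 * (1659831492/78125 + 265841792/15625 * s - 21938176/625 * s^2 - 221184/25 * s^3 + 12288 * s^4)"
    using s s2 s3 \<open>0 \<le> s^4\<close> by (intro mult_nonneg_nonneg) (simp_all add: eval_nat_numeral)
  ultimately show ?thesis by linarith
qed

lemma numerator_quarter_pos:
  fixes x :: real
  assumes "1/4 \<le> x" "x \<le> 9/25"
  shows "0 < 2500*x^8 - 5000*x^7 - 3125*x^6 + 8650*x^5 - 989*x^4 - 3000*x^3 + 1096*x^2 - 20"
proof -
  define s where "s = x - 1/4"
  have s: "0 \<le> s" "s \<le> 11/100" and x: "x = s + 1/4" using assms by (simp_all add: s_def)
  have "2500*x^8 - 5000*x^7 - 3125*x^6 + 8650*x^5 - 989*x^4 - 3000*x^3 + 1096*x^2 - 20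
     = 84853/16384 + s * (34303/512 - 56559/128 * s - 1699/16 * s^2)
       + s^4 * (154977/32 - 825/2 * s - 7500 * s^2 + 2500 * s^4)"
    unfolding x by algebra
  moreover have s2: "s^2 \<le> (11/100)^2" and "0 \<le> s^4" using s by (auto intro!: power_mono)
  have "0 \<le> s * (34303/512 - 56559/128 * s - 1699/16 * s^2)"
    using s s2 by (intro mult_nonneg_nonneg) (simp_all add: power2_eq_square)
  moreover have "0 \<le> s^4 * (154977/32 - 825/2 * s - 7500 * s^2 + 2500 * s^4)"
    using s s2 \<open>0 \<le> s^4\<close> by (intro mult_nonneg_nonneg) (simp_all add: power2_eq_square)
  ultimately show ?thesis by linarith
qed

lemma numerator_quarter_slack_pos:
  fixes x :: real
  assumes "9/25 \<le> x" "x \<le> 4083/10000"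
  shows "0 < 30000*x^8 - 60000*x^7 - 37400*x^6 + 103800*x^5 - 12193*x^4 - 36000*x^3 + 13502*x^2 - 365"
proof -
  define s where "s = x - 9/25"
  have s: "0 \<le> s" "s \<le> 483/10000" and x: "x = s + 9/25" using assms by (simp_all add: s_def)
  have "30000*x^8 - 60000*x^7 - 37400*x^6 + 103800*x^5 - 12193*x^4 - 36000*x^3 + 13502*x^2 - 365
     = 1982348608/244140625 + s * (813525696/9765625 - 641888896/390625 * s)
       + s^3 * (327415212/15625 + 4904467/125 * s - 1547448/25 * s^2 - 79736 * s^3 + 26400 * s^4 + 30000 * s^5)"
    unfolding x by algebra
  moreover have s3: "0 \<le> s^3" "0 \<le> s^4" "0 \<le> s^5"
    using s by auto
  \<comment> \<open>The bound on \<open>s\<close> is rounded up to 1/20 to keep the numerals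
    small.\<close>
  have s4: "s^2 \<le> 1/400" using power_mono[of s "1/20" 2] s by (simp add: power2_eq_square)
  have s5: "s^3 \<le> 1/8000" using power_mono[of s "1/20" 3] s by (simp add: eval_nat_numeral)
  have "0 \<le> s * (813525696/9765625 - 641888896/390625 * s)"
    using s by (intro mult_nonneg_nonneg) simp_all
  moreover have "0 \<le> 327415212/15625 + 4904467/125 * s - 1547448/25 * s^2 - 79736 * s^3 + 26400 * s^4 + 30000 * s^5"
    using s s3 s4 s5 by linarith
  then have "0 \<le> s^3 * (327415212/15625 + 4904467/125 * s - 1547448/25 * s^2 - 79736 * s^3 + 26400 * s^4 + 30000 * s^5)"
    using s3 by (intro mult_nonneg_nonneg) simp_all
  ultimately show ?thesis by linarith
qed

text \<open>Contact at -1/2 with \<kappa> = 1/9 gives the parabola that meets the potential at -1.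
  This choice is exact at \<open>\<mu> = 0\<close>, so the difference to 17/4 has a factor
  \<open>\<mu>\<^sup>2\<close>.\<close>

lemma lower_bound_gt_half:
  assumes "0 < \<mu>" "\<mu> \<le> 4/25"
  shows "17/4 < lower_bound \<mu> (-1/2) (1/9) 0"
proof -
  have D: "1 - \<mu>\<^sup>2 = (1 - \<mu>) * (1 + \<mu>)" by algebra
  have "lower_bound \<mu> (-1/2) (1/9) 0 - 17/4
     = \<mu>\<^sup>2 * (15*\<mu>^3 - 9*\<mu>\<^sup>2 - 5*\<mu> + 1) / (4 * (1 - \<mu>) * (1 + \<mu>)\<^sup>2)"
    using assms unfolding lower_bound_def D
    by (simp add: power_divide divide_simps) algebra
  moreover have "0 < \<dots>" using assms numerator_half_pos[of \<mu>] by simp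
  ultimately show ?thesis by linarith
qed

text \<open>Here \<kappa> is the largest value allowed for contact at -1/3, so the parabola meets
  the potential at the inner product of the poles.\<close>

lemma lower_bound_gt_third:
  assumes "4/25 \<le> \<mu>" "\<mu> \<le> 1/4"
  shows "17/4 < lower_bound \<mu> (-1/3) (9 / (64 * (1 - \<mu>\<^sup>2))) 0"
proof -
  have D: "1 - \<mu>\<^sup>2 = (1 - \<mu>) * (1 + \<mu>)" by algebra
  have pos: "0 < 1 - \<mu>\<^sup>2" "0 < 4 - 3 * \<mu>\<^sup>2"
    using power_mono[of \<mu> "1 / 2" 2] assms by (simp_all add: power2_eq_square)
  have B: "1 / (2 * (1 - (-1/3))\<^sup>2) - 2 * (9 / (64 * (1 - \<mu>\<^sup>2))) * (-1/3) = 3 * (4 - 3 * \<mu>\<^sup>2) / (32 * (1 - \<mu>\<^sup>2))"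
    using pos by (simp add: field_simps power2_eq_square)
  have "lower_bound \<mu> (-1/3) (9 / (64 * (1 - \<mu>\<^sup>2))) 0 - 17/4
     = (12288*\<mu>^8 - 24576*\<mu>^7 - 16384*\<mu>^6 + 43136*\<mu>^5 - 4012*\<mu>^4 - 13824*\<mu>^3 + 4011*\<mu>^2 - 36)
       / (2304 * (1 - \<mu>) * (1 + \<mu>) * (4 - 3 * \<mu>\<^sup>2))"
    using assms pos unfolding lower_bound_def B unfolding D
    by (simp add: power_divide divide_simps) algebra
  moreover have "0 < \<dots>" using assms pos numerator_third_pos[of \<mu>] by simp
  ultimately show ?thesis by linarith
qed

lemma lower_bound_gt_quarter:
  assumes "1/4 \<le> \<mu>" "\<mu> \<le> 9/25"
  shows "17/4 < lower_bound \<mu> (-1/4) (4 / (25 * (1 - \<mu>\<^sup>2))) 0"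
proof -
  have D: "1 - \<mu>\<^sup>2 = (1 - \<mu>) * (1 + \<mu>)" by algebra
  have pos: "0 < 1 - \<mu>\<^sup>2" "0 < 5 - 4 * \<mu>\<^sup>2"
    using power_mono[of \<mu> "1 / 2" 2] assms by (simp_all add: power2_eq_square)
  have B: "1 / (2 * (1 - (-1/4))\<^sup>2) - 2 * (4 / (25 * (1 - \<mu>\<^sup>2))) * (-1/4) = 2 * (5 - 4 * \<mu>\<^sup>2) / (25 * (1 - \<mu>\<^sup>2))"
    using pos by (simp add: field_simps power2_eq_square)
  have "lower_bound \<mu> (-1/4) (4 / (25 * (1 - \<mu>\<^sup>2))) 0 - 17/4
     = (2500*\<mu>^8 - 5000*\<mu>^7 - 3125*\<mu>^6 + 8650*\<mu>^5 - 989*\<mu>^4 - 3000*\<mu>^3 + 1096*\<mu>^2 - 20)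
       / (400 * (1 - \<mu>) * (1 + \<mu>) * (5 - 4 * \<mu>\<^sup>2))"
    using assms pos unfolding lower_bound_def B unfolding D
    by (simp add: power_divide divide_simps) algebra
  moreover have "0 < \<dots>" using assms pos numerator_quarter_pos[of \<mu>] by simp
  ultimately show ?thesis by linarith
qed

text \<open>On this range the linear coefficient in \<open>R\<close> can become negative, down to
  about -0.049 at the right end; hence 1/20.\<close>

lemma lower_bound_gt_quarter_slack:
  assumes "9/25 \<le> \<mu>" "\<mu> \<le> 4083/10000"
  shows "17/4 < lower_bound \<mu> (-1/4) (4 / (25 * (1 - \<mu>\<^sup>2))) (1/20)"
proof -
  have D: "1 - \<mu>\<^sup>2 = (1 - \<mu>) * (1 + \<mu>)" by algebra
  have pos: "0 < 1 - \<mu>\<^sup>2" "0 < 5 - 4 * \<mu>\<^sup>2"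
    using power_mono[of \<mu> "1 / 2" 2] assms by (simp_all add: power2_eq_square)
  have B: "1 / (2 * (1 - (-1/4))\<^sup>2) - 2 * (4 / (25 * (1 - \<mu>\<^sup>2))) * (-1/4) = 2 * (5 - 4 * \<mu>\<^sup>2) / (25 * (1 - \<mu>\<^sup>2))"
    using pos by (simp add: field_simps power2_eq_square)
  have "lower_bound \<mu> (-1/4) (4 / (25 * (1 - \<mu>\<^sup>2))) (1/20) - 17/4
     = (30000*\<mu>^8 - 60000*\<mu>^7 - 37400*\<mu>^6 + 103800*\<mu>^5 - 12193*\<mu>^4 - 36000*\<mu>^3 + 13502*\<mu>^2 - 365)
       / (4800 * (1 - \<mu>) * (1 + \<mu>) * (5 - 4 * \<mu>\<^sup>2))"
    using assms pos unfolding lower_bound_def B unfolding D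
    by (simp add: power_divide divide_simps) algebra
  moreover have "0 < \<dots>" using assms pos numerator_quarter_slack_pos[of \<mu>] by simp
  ultimately show ?thesis by linarith
qed

text \<open>The contact points \<open>-1/2\<close>, \<open>-1/3\<close>, \<open>-1/4\<close> are rounded values of the \<open>\<tau>\<close> that maximizes the bound
  on each range of \<open>\<mu>\<close>; \<open>\<delta> > 0\<close> is needed only on the last one.\<close>

lemma lower_bound_gt:
  assumes "0 < \<mu>" "\<mu> \<le> 4083/10000"
  obtains \<tau> \<kappa> \<delta> where "\<tau> \<le> 0" "0 < \<kappa>" "4 * \<kappa> * (1 - \<tau>)\<^sup>2 * (1 - \<mu>\<^sup>2) \<le> 1" "0 \<le> \<delta>"
    "\<mu>\<^sup>2 / (2 * (1 + \<mu>)) + 3 / 2 * \<kappa> - (1 - \<mu>) / (1 + \<mu>)\<^sup>2 \<le> \<delta>"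
    "17/4 < lower_bound \<mu> \<tau> \<kappa> \<delta>"
proof -
  have D: "0 < 1 - \<mu>\<^sup>2" "\<mu>\<^sup>2 \<le> 1/4"
    using power_mono[of \<mu> "1 / 2" 2] assms by (simp_all add: power2_eq_square)
  \<comment> \<open>The condition on \<delta> is multiplied by
    \<open>(1 - \<mu>) * (1 + \<mu>)\<^sup>2\<close>. The bounds \<open>z\<close>, \<open>w\<close>,
    \<open>v\<close> for its nonlinear pieces are chosen so that only a linear inequality in \<mu>
    remains.\<close>
  have slope: "\<mu>\<^sup>2 / (2 * (1 + \<mu>)) + 3 / 2 * (k / (1 - \<mu>\<^sup>2)) - (1 - \<mu>) / (1 + \<mu>)\<^sup>2 \<le> \<delta>"
    if "\<mu>\<^sup>2 * (1 - \<mu>\<^sup>2) \<le> z" "w \<le> (1 - \<mu>)\<^sup>2" "v \<le> \<delta> * ((1 - \<mu>) * (1 + \<mu>)\<^sup>2)"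
      "z / 2 + 3 / 2 * k * (1 + \<mu>) \<le> w + v" for k \<delta> v w z
  proof -
    have D: "1 - \<mu>\<^sup>2 = (1 - \<mu>) * (1 + \<mu>)" by algebra
    have "\<mu>\<^sup>2 / (2 * (1 + \<mu>)) + 3 / 2 * (k / (1 - \<mu>\<^sup>2)) - (1 - \<mu>) / (1 + \<mu>)\<^sup>2 - \<delta>
      = (1 / 2 * (\<mu>\<^sup>2 * (1 - \<mu>\<^sup>2)) + 3 / 2 * k * (1 + \<mu>) - (1 - \<mu>)\<^sup>2 - \<delta> * ((1 - \<mu>) * (1 + \<mu>)\<^sup>2))
        / ((1 - \<mu>) * (1 + \<mu>)\<^sup>2)"
      unfolding D using assms by (simp add: divide_simps) algebra
    also have "\<dots> \<le> 0"
    proof (rule divide_nonpos_pos)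
      have "1 / 2 * (\<mu>\<^sup>2 * (1 - \<mu>\<^sup>2)) \<le> z / 2" using that(1) by simp
      then show "1 / 2 * (\<mu>\<^sup>2 * (1 - \<mu>\<^sup>2)) + 3 / 2 * k * (1 + \<mu>) - (1 - \<mu>)\<^sup>2
          - \<delta> * ((1 - \<mu>) * (1 + \<mu>)\<^sup>2) \<le> 0"
        using that(2-4) by linarith
    qed (use assms in auto)
    finally show ?thesis by simp
  qed
  consider "\<mu> \<le> 4/25" | "4/25 \<le> \<mu>" "\<mu> \<le> 1/4" | "1/4 \<le> \<mu>" "\<mu> \<le> 9/25" | "9/25 \<le> \<mu>" by linarith
  then show ?thesis
  proof cases
    case 1
    have "4 * (1/9) * (1 - (-1/2))\<^sup>2 * (1 - \<mu>\<^sup>2) \<le> (1::real)" by (simp add: power2_eq_square)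
    moreover have "\<mu>\<^sup>2 / (2 * (1 + \<mu>)) + 3 / 2 * (1/9) - (1 - \<mu>) / (1 + \<mu>)\<^sup>2 \<le> 0"
    proof -
      have "\<mu>\<^sup>2 / (2 * (1 + \<mu>)) \<le> (4/25)\<^sup>2 / 2"
        using assms 1 by (intro frac_le power_mono) auto
      then have "\<mu>\<^sup>2 / (2 * (1 + \<mu>)) \<le> 8/625"
        by (simp add: power2_eq_square)
      moreover have "(1 - 4/25) / (1 + 4/25)\<^sup>2 \<le> (1 - \<mu>) / (1 + \<mu>)\<^sup>2"
        using assms 1 by (intro frac_le power_mono) auto
      then have "525/841 \<le> (1 - \<mu>) / (1 + \<mu>)\<^sup>2"
        by (simp add: power2_eq_square)
      ultimately show ?thesis by linarith
    qed
    ultimately show ?thesis using lower_bound_gt_half[OF assms(1) 1] that[of "-1/2" "1/9" 0] by simp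
  next
    case 2
    have "\<mu>\<^sup>2 / (2 * (1 + \<mu>)) + 3 / 2 * ((9/64) / (1 - \<mu>\<^sup>2)) - (1 - \<mu>) / (1 + \<mu>)\<^sup>2 \<le> 0"
    proof (rule slope)
      show "\<mu>\<^sup>2 * (1 - \<mu>\<^sup>2) \<le> (1/4)\<^sup>2 * 1" using 2 D by (intro mult_mono power_mono) auto
      show "(3/4)\<^sup>2 \<le> (1 - \<mu>)\<^sup>2" using 2 by (intro power_mono) auto
      show "0 \<le> 0 * ((1 - \<mu>) * (1 + \<mu>)\<^sup>2)" by simp
    qed (use 2 in \<open>auto simp: power2_eq_square field_simps\<close>)
    moreover have "4 * (9 / (64 * (1 - \<mu>\<^sup>2))) * (1 - (-1/3))\<^sup>2 * (1 - \<mu>\<^sup>2) \<le> 1"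
      using D by (simp add: power2_eq_square)
    ultimately show ?thesis using D lower_bound_gt_third[OF 2] that[of "-1/3" "9 / (64 * (1 - \<mu>\<^sup>2))" 0] by simp
  next
    case 3
    have "\<mu>\<^sup>2 / (2 * (1 + \<mu>)) + 3 / 2 * ((4/25) / (1 - \<mu>\<^sup>2)) - (1 - \<mu>) / (1 + \<mu>)\<^sup>2 \<le> 0"
    proof (rule slope)
      show "\<mu>\<^sup>2 * (1 - \<mu>\<^sup>2) \<le> (9/25)\<^sup>2 * 1" using 3 D by (intro mult_mono power_mono) auto
      show "(16/25)\<^sup>2 \<le> (1 - \<mu>)\<^sup>2" using 3 by (intro power_mono) auto
      show "0 \<le> 0 * ((1 - \<mu>) * (1 + \<mu>)\<^sup>2)" by simp
    qed (use 3 in \<open>auto simp: power2_eq_square field_simps\<close>)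
    moreover have "4 * (4 / (25 * (1 - \<mu>\<^sup>2))) * (1 - (-1/4))\<^sup>2 * (1 - \<mu>\<^sup>2) \<le> 1"
      using D by (simp add: power2_eq_square)
    ultimately show ?thesis using D lower_bound_gt_quarter[OF 3] that[of "-1/4" "4 / (25 * (1 - \<mu>\<^sup>2))" 0] by simp
  next
    case 4
    have y: "\<mu>\<^sup>2 \<le> 16671/100000"
      using power_mono[of \<mu> "4083/10000" 2] assms by (simp add: power2_eq_square)
    have "\<mu>\<^sup>2 / (2 * (1 + \<mu>)) + 3 / 2 * ((4/25) / (1 - \<mu>\<^sup>2)) - (1 - \<mu>) / (1 + \<mu>)\<^sup>2 \<le> 1/20"
    proof (rule slope)
      \<comment> \<open>The two constants add up to 1, so expanding the product bounds
        \<open>\<mu>\<^sup>2 * (1 - \<mu>\<^sup>2)\<close> by their product.\<close>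
      have "0 \<le> (16671/100000 - \<mu>\<^sup>2) * (83329/100000 - \<mu>\<^sup>2)"
        using y by (intro mult_nonneg_nonneg) auto
      then show "\<mu>\<^sup>2 * (1 - \<mu>\<^sup>2) \<le> 16671/100000 * (83329/100000)"
        by (simp add: algebra_simps)
      show "(5917/10000)\<^sup>2 \<le> (1 - \<mu>)\<^sup>2"
        using assms by (intro power_mono) auto
      have "83329/100000 * (1 + \<mu>) \<le> (1 - \<mu>\<^sup>2) * (1 + \<mu>)"
        using y assms by (intro mult_right_mono) auto
      also have "\<dots> = (1 - \<mu>) * (1 + \<mu>)\<^sup>2" by algebra
      finally show "1/20 * (83329/100000 * (1 + \<mu>)) \<le> 1/20 * ((1 - \<mu>) * (1 + \<mu>)\<^sup>2)" by simp
    qed (use assms in \<open>auto simp: power2_eq_square field_simps\<close>)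
    moreover have "4 * (4 / (25 * (1 - \<mu>\<^sup>2))) * (1 - (-1/4))\<^sup>2 * (1 - \<mu>\<^sup>2) \<le> 1"
      using D by (simp add: power2_eq_square)
    ultimately show ?thesis using D lower_bound_gt_quarter_slack[OF 4 assms(2)] that[of "-1/4" "4 / (25 * (1 - \<mu>\<^sup>2))" "1/20"] by simp
  qed
qed

section \<open>Energy of finite sets\<close>

text \<open>Ordered pairs are summed and the result is halved, so that no labelling is involved and
  any pair of points can be named first.\<close>

definition set_energy :: "(real ^ 3) set \<Rightarrow> real" where
  "set_energy P = (\<Sum>x\<in>P. \<Sum>y\<in>P - {x}. 1 / norm (x - y) ^ 2) / 2"

lemma energy_eq_set_energy:
  assumes "inj_on p {1..5}"
  shows "energy p = set_energy (points p)"
proof -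
  have "(\<Sum>y\<in>points p - {p i}. 1 / norm (p i - y) ^ 2) = (\<Sum>j\<in>{1..5} - {i}. 1 / norm (p i - p j) ^ 2)"
    if "i \<in> {1..5}" for i
  proof -
    have "points p - {p i} = p ` ({1..5} - {i})"
      using assms that by (auto simp: points_def inj_on_def)
    then show ?thesis
      using assms by (simp add: sum.reindex inj_on_subset)
  qed
  then have "set_energy (points p) = (\<Sum>i\<in>{1..5}. \<Sum>j\<in>{1..5} - {i}. 1 / norm (p i - p j) ^ 2) / 2"
    unfolding set_energy_def using assms by (simp add: points_def sum.reindex)
  also have "{1..5::nat} = {1, 2, 3, 4, 5}" by auto
  also have "(\<Sum>i\<in>{1, 2, 3, 4, 5::nat}. \<Sum>j\<in>{1, 2, 3, 4, 5} - {i}. 1 / norm (p i - p j) ^ 2) / 2 = energy p"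
  proof -
    have "{1..5::nat} = {1, 2, 3, 4, 5}" "{1..<Suc 0} = {}" "{1..<2::nat} = {1}" "{1..<3::nat} = {1, 2}"
      "{1..<4::nat} = {1, 2, 3}" "{1..<5::nat} = {1, 2, 3, 4}" by auto
    then show ?thesis
      unfolding energy_def by (simp add: insert_Diff_if norm_minus_commute)
  qed
  finally show ?thesis ..
qed

lemma set_energy_five:
  assumes "distinct [a, b, x, y, z]"
  shows "set_energy {a, b, x, y, z} =
    1 / norm (a - b) ^ 2
    + (1 / norm (x - a) ^ 2 + 1 / norm (x - b) ^ 2) + (1 / norm (y - a) ^ 2 + 1 / norm (y - b) ^ 2)
    + (1 / norm (z - a) ^ 2 + 1 / norm (z - b) ^ 2)
    + (1 / norm (x - y) ^ 2 + 1 / norm (x - z) ^ 2 + 1 / norm (y - z) ^ 2)"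
proof -
  have d: "a \<noteq> b" "a \<noteq> x" "a \<noteq> y" "a \<noteq> z" "b \<noteq> x" "b \<noteq> y" "b \<noteq> z" "x \<noteq> y" "x \<noteq> z" "y \<noteq> z"
    using assms by auto
  show ?thesis
    unfolding set_energy_def by (simp add: insert_Diff_if d d[symmetric] norm_minus_commute)
qed

lemma norm_diff_unit:
  assumes "norm x = 1" "norm y = 1"
  shows "norm (x - y) ^ 2 = 2 - 2 * (x \<bullet> y)"
  using assms by (simp add: power2_norm_eq_inner inner_diff inner_commute norm_eq_1)

lemma inner_unit_less_1:
  assumes "norm x = 1" "norm y = 1" "x \<noteq> y"
  shows "x \<bullet> y < 1"
proof -
  have "0 < norm (x - y) ^ 2" using assms(3) by simp
  then show ?thesis using norm_diff_unit[OF assms(1,2)] by simp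
qed

text \<open>This is the frame potential bound. The double sum is the squared Frobenius norm of the
  second moment matrix of \<open>P\<close>, whose trace is \<open>card P\<close>; the off-diagonal
  entries are dropped and Cauchy-Schwarz is applied to the diagonal.\<close>

lemma card_square_le_sum_inner_square:
  fixes P :: "'a::euclidean_space set"
  assumes "finite P" and unit: "\<And>x. x \<in> P \<Longrightarrow> norm x = 1"
  shows "(real (card P))\<^sup>2 \<le> real DIM('a) * (\<Sum>x\<in>P. \<Sum>y\<in>P. (x \<bullet> y)\<^sup>2)"
proof -
  have "(\<Sum>i\<in>Basis. \<Sum>x\<in>P. (x \<bullet> i)\<^sup>2) = (\<Sum>x\<in>P. \<Sum>i\<in>Basis. (x \<bullet> i)\<^sup>2)"
    by (rule sum.swap)
  also have "\<dots> = (\<Sum>x\<in>P. 1)"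
  proof (rule sum.cong)
    fix x assume "x \<in> P"
    then have "x \<bullet> x = 1" using unit by (simp add: norm_eq_1)
    then show "(\<Sum>i\<in>Basis. (x \<bullet> i)\<^sup>2) = 1"
      by (simp add: euclidean_inner[of x x] power2_eq_square)
  qed simp
  finally have "(real (card P))\<^sup>2 = (\<Sum>i\<in>Basis. \<Sum>x\<in>P. (x \<bullet> i)\<^sup>2)\<^sup>2" by simp
  also have "\<dots> \<le> (\<Sum>i\<in>Basis. (\<Sum>x\<in>P. (x \<bullet> i)\<^sup>2)\<^sup>2) * real (card (Basis :: 'a set))"
    by (rule sum_squared_le_sum_of_squares)
  also have "(\<Sum>i\<in>Basis. (\<Sum>x\<in>P. (x \<bullet> i)\<^sup>2)\<^sup>2)
      \<le> (\<Sum>i\<in>Basis. \<Sum>j\<in>Basis. (\<Sum>x\<in>P. (x \<bullet> i) * (x \<bullet> j))\<^sup>2)"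
  proof (rule sum_mono)
    fix i :: 'a assume "i \<in> Basis"
    then show "(\<Sum>x\<in>P. (x \<bullet> i)\<^sup>2)\<^sup>2 \<le> (\<Sum>j\<in>Basis. (\<Sum>x\<in>P. (x \<bullet> i) * (x \<bullet> j))\<^sup>2)"
      using member_le_sum[of i Basis "\<lambda>j. (\<Sum>x\<in>P. (x \<bullet> i) * (x \<bullet> j))\<^sup>2"]
      by (simp add: power2_eq_square)
  qed
  also have "(\<Sum>i\<in>Basis. \<Sum>j\<in>Basis. (\<Sum>x\<in>P. (x \<bullet> i) * (x \<bullet> j))\<^sup>2)
     = (\<Sum>x\<in>P. \<Sum>y\<in>P. (x \<bullet> y)\<^sup>2)"
  proof -
    have "(\<Sum>i\<in>Basis. \<Sum>j\<in>Basis. (\<Sum>x\<in>P. (x \<bullet> i) * (x \<bullet> j))\<^sup>2)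
       = (\<Sum>i\<in>Basis. \<Sum>j\<in>Basis. \<Sum>x\<in>P. \<Sum>y\<in>P. (x \<bullet> i) * (x \<bullet> j) * ((y \<bullet> i) * (y \<bullet> j)))"
      by (simp add: power2_eq_square sum_product)
    also have "\<dots> = (\<Sum>x\<in>P. \<Sum>y\<in>P. \<Sum>i\<in>Basis. \<Sum>j\<in>Basis. (x \<bullet> i) * (x \<bullet> j) * ((y \<bullet> i) * (y \<bullet> j)))"
      by (simp add: sum.swap[of _ Basis P])
    also have "\<dots> = (\<Sum>x\<in>P. \<Sum>y\<in>P. (x \<bullet> y)\<^sup>2)"
    proof -
      have "(x \<bullet> y)\<^sup>2 = (\<Sum>i\<in>Basis. \<Sum>j\<in>Basis. (x \<bullet> i) * (x \<bullet> j) * ((y \<bullet> i) * (y \<bullet> j)))" for x y :: 'a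
        by (subst euclidean_inner) (simp add: power2_eq_square sum_product mult_ac)
      then show ?thesis by simp
    qed
    finally show ?thesis .
  qed
  finally show ?thesis by (simp add: mult.commute)
qed

text \<open>The parabola touches at 0 and meets the potential at \<open>m\<close>. Its sum gives
  twice the energy at least \<open>15/2 + 10/3 * \<kappa>\<close>, which exceeds 17/2 exactly when
  \<kappa> > 3/10, that is, when \<open>m > - 2 / 3\<close>.\<close>

lemma set_energy_gt_if_no_far_pair:
  assumes "card P = 5" and S2: "P \<subseteq> S2"
    and m: "\<And>x y. x \<in> P \<Longrightarrow> y \<in> P \<Longrightarrow> x \<noteq> y \<Longrightarrow> m \<le> x \<bullet> y" "- 2 / 3 < m" "m < 1"
  shows "17 / 4 < set_energy P"
proof -
  have fin: "finite P" using assms(1) by (simp add: card_ge_0_finite)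
  have unit: "norm x = 1" if "x \<in> P" for x using that S2 by auto
  define \<kappa> where "\<kappa> = 1 / (2 * (1 - m))"
  have \<kappa>: "3 / 10 < \<kappa>" using m by (simp add: \<kappa>_def field_simps)
  \<comment> \<open>The diagonal is added and subtracted, so that the full double sums become a
    squared length and the frame potential.\<close>
  have split: "(\<Sum>x\<in>P. \<Sum>y\<in>P - {x}. g x y) = (\<Sum>x\<in>P. \<Sum>y\<in>P. g x y) - (\<Sum>x\<in>P. g x x)" for g :: "_ \<Rightarrow> _ \<Rightarrow> real"
    using fin by (simp add: sum_diff1 sum_subtractf)
  have "(\<Sum>x\<in>P. \<Sum>y\<in>P - {x}. 1 / 2 + (x \<bullet> y) / 2 + \<kappa> * (x \<bullet> y)\<^sup>2)
      \<le> (\<Sum>x\<in>P. \<Sum>y\<in>P - {x}. 1 / norm (x - y) ^ 2)"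
  proof (intro sum_mono)
    fix x y assume "x \<in> P" "y \<in> P - {x}"
    then have xy: "norm x = 1" "norm y = 1" "x \<noteq> y" "m \<le> x \<bullet> y" using unit m by auto
    then have "x \<bullet> y < 1" by (simp add: inner_unit_less_1)
    moreover have "2 * \<kappa> * (1 - 0)\<^sup>2 * (1 - x \<bullet> y) \<le> 1"
      using xy m by (simp add: \<kappa>_def)
    ultimately show "1 / 2 + (x \<bullet> y) / 2 + \<kappa> * (x \<bullet> y)\<^sup>2 \<le> 1 / norm (x - y) ^ 2"
      using riesz_ge_quadratic[of "x \<bullet> y" 0 \<kappa>] by (simp add: norm_diff_unit[OF xy(1,2)])
  qed
  also have "(\<Sum>x\<in>P. \<Sum>y\<in>P - {x}. 1 / 2 + (x \<bullet> y) / 2 + \<kappa> * (x \<bullet> y)\<^sup>2)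
     = 25 / 2 + (\<Sum>x\<in>P. \<Sum>y\<in>P. x \<bullet> y) / 2 + \<kappa> * (\<Sum>x\<in>P. \<Sum>y\<in>P. (x \<bullet> y)\<^sup>2) - 5 * (1 + \<kappa>)"
    unfolding split using unit assms(1)
    by (simp add: sum.distrib sum_distrib_left sum_divide_distrib norm_eq_1 algebra_simps)
  also have "(\<Sum>x\<in>P. \<Sum>y\<in>P. x \<bullet> y) = (\<Sum>x\<in>P. x) \<bullet> (\<Sum>x\<in>P. x)"
    by (simp add: inner_sum_left inner_sum_right) (rule sum.swap)
  finally have main: "25 / 2 + ((\<Sum>x\<in>P. x) \<bullet> (\<Sum>x\<in>P. x)) / 2 + \<kappa> * (\<Sum>x\<in>P. \<Sum>y\<in>P. (x \<bullet> y)\<^sup>2) - 5 * (1 + \<kappa>)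
     \<le> 2 * set_energy P" by (simp add: set_energy_def)
  define N where "N = (\<Sum>x\<in>P. x) \<bullet> (\<Sum>x\<in>P. x)"
  define T where "T = (\<Sum>x\<in>P. \<Sum>y\<in>P. (x \<bullet> y)\<^sup>2)"
  define X where "X = \<kappa> * T"
  have "0 \<le> N" by (simp add: N_def)
  moreover have "25 / 3 * \<kappa> \<le> X"
    using card_square_le_sum_inner_square[OF fin unit] assms(1) \<kappa> by (simp add: X_def T_def)
  ultimately show ?thesis
    using \<kappa> main[folded N_def T_def, folded X_def] by argo
qed

section \<open>Normal form of a bi-pyramid\<close>

text \<open>The matrix with rows \<open>e\<close>, \<open>cross3 e k\<close>, \<open>k\<close> is
  orthogonal. It provides the coordinates in which the poles lie in the plane of the first and third
  axes.\<close>

lemma orthonormal_pair_frame: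
  fixes e k :: "real ^ 3"
  assumes "norm e = 1" "norm k = 1" "e \<bullet> k = 0"
  obtains f :: "real ^ 3 \<Rightarrow> real ^ 3" where "orthogonal_transformation f" "f e = axis 1 1" "f k = axis 3 1"
proof -
  define l where "l = cross3 e k"
  have l: "l \<bullet> e = 0" "l \<bullet> k = 0" by (simp_all add: l_def dot_cross_self inner_commute)
  have "norm l = 1"
    using norm_cross_dot[of e k] assms by (simp add: l_def power2_eq_1_iff) (smt (verit) norm_ge_zero)
  define A :: "real^3^3" where "A = vector [e, l, k]"
  have rows: "row 1 A = e" "row 2 A = l" "row 3 A = k"
    by (simp_all add: A_def row_def vec_eq_iff)
  have "orthogonal_matrix A"
    unfolding orthogonal_matrix_orthonormal_rows
    using assms l \<open>norm l = 1\<close>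
    by (simp add: forall_3 rows orthogonal_def inner_commute)
  then have "orthogonal_transformation ((*v) A)"
    by (simp add: orthogonal_transformation_matrix)
  moreover have "A *v e = axis 1 1" "A *v k = axis 3 1"
    using assms l by (simp_all add: vec_eq_iff forall_3 matrix_vector_mul_component rows[unfolded row_def] A_def
      axis_def inner_commute norm_eq_1)
  ultimately show ?thesis using that by blast
qed

definition standard_bipyramid :: "(real ^ 3) set" where
  "standard_bipyramid = {axis 3 1, - axis 3 1, axis 1 1,
     vector [- 1 / 2, sqrt 3 / 2, 0], vector [- 1 / 2, - sqrt 3 / 2, 0]}"

lemma inner_3: "(x :: real ^ 3) \<bullet> y = x $ 1 * y $ 1 + x $ 2 * y $ 2 + x $ 3 * y $ 3"
  by (simp add: inner_vec_def sum_3)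

lemma axis_3_component:
  "(axis 1 1 :: real ^ 3) $ 1 = 1" "(axis 1 1 :: real ^ 3) $ 2 = 0" "(axis 1 1 :: real ^ 3) $ 3 = 0"
  "(axis 3 1 :: real ^ 3) $ 1 = 0" "(axis 3 1 :: real ^ 3) $ 2 = 0" "(axis 3 1 :: real ^ 3) $ 3 = 1"
  by (simp_all add: axis_def)

lemma triangular_bipyramid_standard: "triangular_bipyramid standard_bipyramid"
proof -
  define u v w :: "real ^ 3" where "u = axis 1 1" and "v = vector [- 1 / 2, sqrt 3 / 2, 0]"
    and "w = vector [- 1 / 2, - sqrt 3 / 2, 0]"
  note defs = u_def v_def w_def
  have "standard_bipyramid = {axis 3 1, - axis 3 1, u, v, w}"
    by (simp add: standard_bipyramid_def defs)
  moreover have "axis 3 1 \<in> S2" "{u, v, w} \<subseteq> {x \<in> S2. axis 3 1 \<bullet> x = 0}"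
    by (auto simp: norm_eq_1 inner_3 axis_3_component defs)
  moreover have "u $ 2 \<noteq> v $ 2" by (simp add: axis_3_component defs)
  then have "u \<noteq> v" by auto
  moreover have "dist u v = dist v w" "dist v w = dist w u"
    by (simp_all add: dist_norm norm_eq_sqrt_inner inner_3 axis_3_component defs)
  ultimately show ?thesis unfolding triangular_bipyramid_def by blast
qed

lemma distinct_standard_bipyramid:
  "distinct [axis 3 1, - axis 3 1, axis 1 1, vector [- 1 / 2, sqrt 3 / 2, 0],
     vector [- 1 / 2, - sqrt 3 / 2, 0] :: real ^ 3]"
  by (simp add: vec_eq_iff forall_3 axis_3_component)

lemma set_energy_standard: "set_energy standard_bipyramid = 17 / 4"
  unfolding standard_bipyramid_def set_energy_five[OF distinct_standard_bipyramid]
  by (simp add: power2_norm_eq_inner inner_3 axis_3_component)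

text \<open>Once \<open>u\<close> and \<open>a\<close> lie on coordinate axes, \<open>v\<close> and
  \<open>w\<close> lie on the equator with the same first coordinate \<open>c\<close>, and equal
  sides force \<open>c = - 1 / 2\<close>. Uniqueness up to isometry follows by passing through this
  one set.\<close>

lemma triangular_bipyramid_normal_form:
  assumes "triangular_bipyramid P"
  obtains f where "orthogonal_transformation f" "f ` P = standard_bipyramid"
proof -
  obtain a u v w where P: "P = {a, -a, u, v, w}" and S2: "a \<in> S2" "{u, v, w} \<subseteq> {x \<in> S2. a \<bullet> x = 0}"
    and "u \<noteq> v" and d: "dist u v = dist v w" "dist v w = dist w u"
    using assms unfolding triangular_bipyramid_def by (elim exE conjE) (rule that)
  have unit: "norm a = 1" "norm u = 1" "norm v = 1" "norm w = 1"
    and eq: "a \<bullet> u = 0" "a \<bullet> v = 0" "a \<bullet> w = 0"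
    using S2 by auto
  have "u \<bullet> a = 0" using eq by (simp only: inner_commute)
  from orthonormal_pair_frame[OF unit(2,1) this]
  obtain f :: "real ^ 3 \<Rightarrow> real ^ 3"
    where f: "orthogonal_transformation f" "f u = axis 1 1" "f a = axis 3 1" .
  have in_f: "f x \<bullet> f y = x \<bullet> y" for x y using f by (simp add: orthogonal_transformation_def)
  have "norm (u - v) ^ 2 = norm (v - w) ^ 2"
    using d(1) by (simp only: dist_norm)
  moreover have "norm (v - w) ^ 2 = norm (w - u) ^ 2"
    using d(2) by (simp only: dist_norm)
  ultimately have c: "v \<bullet> w = u \<bullet> v" "u \<bullet> w = u \<bullet> v"
    using unit by (simp_all add: norm_diff_unit inner_commute[of w u])
  define c where "c = u \<bullet> v"
  have "c < 1" using inner_unit_less_1[OF unit(2,3) \<open>u \<noteq> v\<close>] by (simp add: c_def)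
  have v: "f v $ 1 = c" "f v $ 3 = 0" "(f v $ 1)\<^sup>2 + (f v $ 2)\<^sup>2 + (f v $ 3)\<^sup>2 = 1"
    using in_f[of u v] in_f[of a v] in_f[of v v] f unit eq
    by (simp_all add: inner_axis' c_def norm_eq_1 power2_eq_square inner_3[of "f v" "f v"])
  have w: "f w $ 1 = c" "f w $ 3 = 0" "(f w $ 1)\<^sup>2 + (f w $ 2)\<^sup>2 + (f w $ 3)\<^sup>2 = 1"
    using in_f[of u w] in_f[of a w] in_f[of w w] f unit eq c
    by (simp_all add: inner_axis' c_def norm_eq_1 power2_eq_square inner_3[of "f w" "f w"])
  have vw: "c\<^sup>2 + f v $ 2 * f w $ 2 = c"
    using in_f[of v w] c v w by (simp add: inner_3 c_def power2_eq_square)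
  have "(f v $ 2)\<^sup>2 = (f w $ 2)\<^sup>2" using v w by simp
  \<comment> \<open>If \<open>v\<close> and \<open>w\<close> coincided, the equal distances would
    make \<open>u\<close> coincide with them too.\<close>
  moreover have "f v $ 2 \<noteq> f w $ 2"
  proof
    assume "f v $ 2 = f w $ 2"
    then have "c = 1" using vw v w by (simp add: power2_eq_square)
    with \<open>c < 1\<close> show False by simp
  qed
  ultimately have neg: "f w $ 2 = - f v $ 2" by (auto simp: power2_eq_iff)
  have "(f v $ 2)\<^sup>2 = 1 - c\<^sup>2" using v by simp
  then have "(c - 1) * (2 * c + 1) = 0"
    using vw neg by (simp add: algebra_simps power2_eq_square)
  then have c': "c = - 1 / 2" using \<open>c < 1\<close> by simp
  then have "(f v $ 2)\<^sup>2 = (sqrt 3 / 2)\<^sup>2" using v by (simp add: power2_eq_square)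
  then consider "f v $ 2 = sqrt 3 / 2" | "f v $ 2 = - sqrt 3 / 2" by (auto simp: power2_eq_iff)
  then have "{f v, f w} = {vector [- 1 / 2, sqrt 3 / 2, 0], vector [- 1 / 2, - sqrt 3 / 2, 0]}"
  proof cases
    case 1
    then have "f v = vector [- 1 / 2, sqrt 3 / 2, 0]" "f w = vector [- 1 / 2, - sqrt 3 / 2, 0]"
      using v w neg c' by (simp_all add: vec_eq_iff forall_3)
    then show ?thesis by simp
  next
    case 2
    then have "f w = vector [- 1 / 2, sqrt 3 / 2, 0]" "f v = vector [- 1 / 2, - sqrt 3 / 2, 0]"
      using v w neg c' by (simp_all add: vec_eq_iff forall_3)
    then show ?thesis by auto
  qed
  then have "f ` P = standard_bipyramid"
    using f by (simp add: P standard_bipyramid_def orthogonal_transformation_linear linear_neg)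
  with f that show ?thesis by blast
qed

lemma set_energy_orthogonal_image:
  assumes "orthogonal_transformation f"
  shows "set_energy (f ` P) = set_energy P"
proof -
  have inj: "inj f" using assms by (rule orthogonal_transformation_inj)
  have n: "norm (f x - f y) = norm (x - y)" for x y
    using assms by (metis dist_norm orthogonal_transformation_isometry)
  have "(\<Sum>y\<in>f ` P - {f x}. 1 / norm (f x - y) ^ 2) = (\<Sum>y\<in>P - {x}. 1 / norm (x - y) ^ 2)" for x
  proof -
    have "f ` P - {f x} = f ` (P - {x})" using inj by (auto simp: inj_def)
    then show ?thesis using inj by (simp add: sum.reindex inj_on_subset n)
  qed
  then show ?thesis
    unfolding set_energy_def using inj by (simp add: sum.reindex inj_on_subset)
qed

section \<open>Minimality and uniqueness\<close>

lemma sum_three_squares_le_0D: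
  fixes u v w :: real
  assumes "u\<^sup>2 + v\<^sup>2 + w\<^sup>2 \<le> 0"
  shows "u = 0" "v = 0" "w = 0"
proof -
  have "0 \<le> u\<^sup>2" "0 \<le> v\<^sup>2" "0 \<le> w\<^sup>2" by simp_all
  with assms have "u\<^sup>2 = 0" "v\<^sup>2 = 0" "w\<^sup>2 = 0" by argo+
  then show "u = 0" "v = 0" "w = 0" by simp_all
qed

text \<open>All square terms of the estimates are kept in \<open>bound\<close>. At energy 17/4 they
  must vanish, which puts the three points on the equator with mutual inner products -1/2.\<close>

lemma antipodal_set_energy:
  assumes unit: "norm a = 1" "norm x = 1" "norm y = 1" "norm z = 1"
    and dist: "distinct [a, - a, x, y, z]"
  shows "17 / 4 \<le> set_energy {a, - a, x, y, z}"
    and "set_energy {a, - a, x, y, z} \<le> 17 / 4 \<Longrightarrow> triangular_bipyramid {a, - a, x, y, z}"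
proof -
  have pole: "1 + (v \<bullet> a)\<^sup>2 \<le> 1 / norm (v - a) ^ 2 + 1 / norm (v - - a) ^ 2"
    if "norm v = 1" "v \<noteq> a" "v \<noteq> - a" for v
  proof -
    have "v \<bullet> a < 1" "v \<bullet> - a < 1"
      using inner_unit_less_1[of v a] inner_unit_less_1[of v "- a"] that unit by auto
    then have "\<bar>v \<bullet> a\<bar> < 1 - 0" by (simp add: abs_if)
    from riesz_sum_symmetric_ge[of 0 0, OF _ this] show ?thesis
      using norm_diff_unit[of v a] norm_diff_unit[of v "- a"] that unit by simp
  qed
  \<comment> \<open>The numbers 1/3 and 2/9 are the value and slope of the potential at
    -1/2.\<close>
  have side: "1 / 3 + 2 / 9 * (v \<bullet> w + 1 / 2) + 1 / 9 * (v \<bullet> w + 1 / 2)\<^sup>2 \<le> 1 / norm (v - w) ^ 2"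
    if "norm v = 1" "norm w = 1" "v \<noteq> w" for v w :: "real ^ 3"
  proof -
    have "- 1 \<le> v \<bullet> w"
      using Cauchy_Schwarz_ineq2[of v w] that by (simp add: abs_le_iff)
    then show ?thesis
      unfolding norm_diff_unit[OF that(1,2)]
      using riesz_ge_quadratic[of "v \<bullet> w" "- 1 / 2" "1 / 9"] inner_unit_less_1[OF that]
      by (simp add: power2_eq_square algebra_simps)
  qed
  have "(x + y + z) \<bullet> (x + y + z) = 3 + 2 * (x \<bullet> y + x \<bullet> z + y \<bullet> z)"
    using unit by (simp add: inner_add inner_commute norm_eq_1)
  then have "0 \<le> 3 + 2 * (x \<bullet> y + x \<bullet> z + y \<bullet> z)"
    using inner_ge_zero[of "x + y + z"] by (simp only:)
  then have sum: "- 3 / 2 \<le> x \<bullet> y + x \<bullet> z + y \<bullet> z" by argo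
  have ne: "x \<noteq> a" "x \<noteq> - a" "y \<noteq> a" "y \<noteq> - a" "z \<noteq> a" "z \<noteq> - a" "x \<noteq> y" "x \<noteq> z" "y \<noteq> z"
    using dist by auto
  have "1 / norm (a - - a) ^ 2 = 1 / 4"
    using norm_diff_unit[of a "- a"] unit by (simp add: norm_eq_1)
  \<comment> \<open>The constant is 1/4 for the poles, 3 for the pole-equator pairs and 1 for the
    triangle.\<close>
  then have bound: "17 / 4 + 2 / 9 * (x \<bullet> y + x \<bullet> z + y \<bullet> z + 3 / 2)
      + ((x \<bullet> a)\<^sup>2 + (y \<bullet> a)\<^sup>2 + (z \<bullet> a)\<^sup>2)
      + 1 / 9 * ((x \<bullet> y + 1 / 2)\<^sup>2 + (x \<bullet> z + 1 / 2)\<^sup>2 + (y \<bullet> z + 1 / 2)\<^sup>2)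
    \<le> set_energy {a, - a, x, y, z}"
    unfolding set_energy_five[OF dist]
    using pole[OF unit(2) ne(1,2)] pole[OF unit(3) ne(3,4)] pole[OF unit(4) ne(5,6)]
      side[OF unit(2,3) ne(7)] side[OF unit(2,4) ne(8)] side[OF unit(3,4) ne(9)] by argo
  have nonneg: "0 \<le> (x \<bullet> a)\<^sup>2 + (y \<bullet> a)\<^sup>2 + (z \<bullet> a)\<^sup>2"
    "0 \<le> (x \<bullet> y + 1 / 2)\<^sup>2 + (x \<bullet> z + 1 / 2)\<^sup>2 + (y \<bullet> z + 1 / 2)\<^sup>2" by simp_all
  from bound sum nonneg show "17 / 4 \<le> set_energy {a, - a, x, y, z}" by argo
  assume "set_energy {a, - a, x, y, z} \<le> 17 / 4"
  with bound sum nonneg have "(x \<bullet> a)\<^sup>2 + (y \<bullet> a)\<^sup>2 + (z \<bullet> a)\<^sup>2 \<le> 0"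
    "(x \<bullet> y + 1 / 2)\<^sup>2 + (x \<bullet> z + 1 / 2)\<^sup>2 + (y \<bullet> z + 1 / 2)\<^sup>2 \<le> 0" by argo+
  from this[THEN sum_three_squares_le_0D(1)] this[THEN sum_three_squares_le_0D(2)]
    this[THEN sum_three_squares_le_0D(3)]
  have eq: "x \<bullet> a = 0" "y \<bullet> a = 0" "z \<bullet> a = 0"
    "x \<bullet> y = - 1 / 2" "x \<bullet> z = - 1 / 2" "y \<bullet> z = - 1 / 2"
    by argo+
  have "(dist x y)\<^sup>2 = 3" "(dist y z)\<^sup>2 = 3" "(dist z x)\<^sup>2 = 3"
    using norm_diff_unit[of x y] norm_diff_unit[of y z] norm_diff_unit[of z x] unit eq
    by (simp_all add: dist_norm inner_commute[of z x])
  then have "dist x y = sqrt 3" "dist y z = sqrt 3" "dist z x = sqrt 3"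
    by (metis real_sqrt_unique zero_le_dist)+
  then have "dist x y = dist y z \<and> dist y z = dist z x" by simp
  moreover have "{x, y, z} \<subseteq> {v \<in> S2. a \<bullet> v = 0}" "a \<in> S2" "x \<noteq> y"
    using unit eq dist by (auto simp: inner_commute)
  ultimately show "triangular_bipyramid {a, - a, x, y, z}"
    unfolding triangular_bipyramid_def by blast
qed

text \<open>In the frame of the normalized sum and difference of \<open>a\<close> and
  \<open>b\<close> the energy takes the form treated by \<open>energy_ge_lower_bound\<close>.
  Minimality of \<open>a \<bullet> b\<close> places the other inner products where the parabola lies
  below the potential.\<close>

lemma set_energy_gt_if_far_pair:
  assumes unit: "norm a = 1" "norm b = 1" "norm x = 1" "norm y = 1" "norm z = 1"
    and dist: "distinct [a, b, x, y, z]"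
    and m: "- 1 < a \<bullet> b" "a \<bullet> b \<le> - 2 / 3"
    and min: "a \<bullet> b \<le> x \<bullet> y" "a \<bullet> b \<le> x \<bullet> z" "a \<bullet> b \<le> y \<bullet> z"
  shows "17 / 4 < set_energy {a, b, x, y, z}"
proof -
  \<comment> \<open>These are half the lengths of \<open>a + b\<close> and
    \<open>a - b\<close>.\<close>
  define \<mu> \<nu> where "\<mu> = sqrt ((1 + a \<bullet> b) / 2)" and "\<nu> = sqrt ((1 - a \<bullet> b) / 2)"
  have \<mu>: "0 < \<mu>" "\<mu>\<^sup>2 = (1 + a \<bullet> b) / 2" and \<nu>: "0 < \<nu>" "\<nu>\<^sup>2 = (1 - a \<bullet> b) / 2"
    using m by (simp_all add: \<mu>_def \<nu>_def)
  \<comment> \<open>From \<open>a \<bullet> b \<le> - 2 / 3\<close> comes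
    \<open>\<mu>\<^sup>2 \<le> 1 / 6\<close>; 0.4083 is the square root of 1/6 rounded up.\<close>
  have "\<mu>\<^sup>2 \<le> (4083 / 10000)\<^sup>2"
    using \<mu> m by (simp add: power2_eq_square)
  then have \<mu>_le: "\<mu> \<le> 4083 / 10000"
    by (rule power2_le_imp_le) simp
  define e k where "e = (1 / (2 * \<mu>)) *\<^sub>R (a + b)" and "k = (1 / (2 * \<nu>)) *\<^sub>R (a - b)"
  have "(a + b) \<bullet> (a + b) = (2 * \<mu>)\<^sup>2" "(a - b) \<bullet> (a - b) = (2 * \<nu>)\<^sup>2"
    using unit \<mu> \<nu> by (simp_all add: inner_add inner_diff inner_commute norm_eq_1 power_mult_distrib)
  moreover have "e \<bullet> e = ((a + b) \<bullet> (a + b)) / (2 * \<mu>)\<^sup>2" "k \<bullet> k = ((a - b) \<bullet> (a - b)) / (2 * \<nu>)\<^sup>2"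
    by (simp_all add: e_def k_def power2_eq_square)
  ultimately have "norm e = 1" "norm k = 1"
    using \<mu> \<nu> m by (simp_all add: norm_eq_1)
  moreover have "e \<bullet> k = 0"
    using unit by (simp add: e_def k_def inner_add inner_diff inner_commute norm_eq_1)
  ultimately obtain f :: "real ^ 3 \<Rightarrow> real ^ 3"
    where f: "orthogonal_transformation f" "f e = axis 1 1" "f k = axis 3 1"
    by (rule orthonormal_pair_frame)
  have in_f: "f v \<bullet> f w = v \<bullet> w" for v w
    using f by (simp add: orthogonal_transformation_def)
  have ab: "a = \<mu> *\<^sub>R e + \<nu> *\<^sub>R k" "b = \<mu> *\<^sub>R e - \<nu> *\<^sub>R k"
    using \<mu> \<nu> by (simp_all add: e_def k_def algebra_simps flip: scaleR_add_left)
  have in_ek: "v \<bullet> e = f v $ 1" "v \<bullet> k = f v $ 3" for v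
    using in_f[of v e] in_f[of v k] f by (simp_all add: inner_axis)
  have in_ab: "v \<bullet> a = \<mu> * f v $ 1 + \<nu> * f v $ 3" "v \<bullet> b = \<mu> * f v $ 1 - \<nu> * f v $ 3" for v
    unfolding ab by (simp_all add: inner_add_right inner_diff_right in_ek)
  have norm_f: "(f v $ 1)\<^sup>2 + (f v $ 2)\<^sup>2 + (f v $ 3)\<^sup>2 = 1" if "norm v = 1" for v
    using that in_f[of v v] by (simp add: norm_eq_1 inner_3 power2_eq_square)
  have pole: "\<bar>\<nu> * f v $ 3\<bar> < 1 - \<mu> * f v $ 1" if "norm v = 1" "v \<noteq> a" "v \<noteq> b" for v
    using inner_unit_less_1[of v a] inner_unit_less_1[of v b] that unit in_ab[of v] by linarith
  obtain \<tau> \<kappa> \<delta> where par: "\<tau> \<le> 0" "0 < \<kappa>" "4 * \<kappa> * (1 - \<tau>)\<^sup>2 * (1 - \<mu>\<^sup>2) \<le> 1" "0 \<le> \<delta>"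
    "\<mu>\<^sup>2 / (2 * (1 + \<mu>)) + 3 / 2 * \<kappa> - (1 - \<mu>) / (1 + \<mu>)\<^sup>2 \<le> \<delta>"
    and gt: "17 / 4 < lower_bound \<mu> \<tau> \<kappa> \<delta>"
    using lower_bound_gt[OF \<mu>(1) \<mu>_le] by blast
  have xyz: "v \<bullet> w = f v $ 1 * f w $ 1 + f v $ 2 * f w $ 2 + f v $ 3 * f w $ 3" for v w
    unfolding in_f[of v w, symmetric] by (rule inner_3)
  have ne: "x \<noteq> a" "x \<noteq> b" "y \<noteq> a" "y \<noteq> b" "z \<noteq> a" "z \<noteq> b" "x \<noteq> y" "x \<noteq> z" "y \<noteq> z"
    using dist by auto
  have lt: "x \<bullet> y < 1" "x \<bullet> z < 1" "y \<bullet> z < 1"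
    using unit ne by (simp_all add: inner_unit_less_1)
  have "lower_bound \<mu> \<tau> \<kappa> \<delta> \<le> 1 / (4 * (1 - \<mu>\<^sup>2))
      + (1 / (2 - 2 * (x \<bullet> a)) + 1 / (2 - 2 * (x \<bullet> b)))
      + (1 / (2 - 2 * (y \<bullet> a)) + 1 / (2 - 2 * (y \<bullet> b)))
      + (1 / (2 - 2 * (z \<bullet> a)) + 1 / (2 - 2 * (z \<bullet> b)))
      + (1 / (2 - 2 * (x \<bullet> y)) + 1 / (2 - 2 * (x \<bullet> z)) + 1 / (2 - 2 * (y \<bullet> z)))"
    unfolding in_ab xyz[of x y] xyz[of x z] xyz[of y z]
  proof (rule energy_ge_lower_bound[OF norm_f[OF unit(3)] norm_f[OF unit(4)] norm_f[OF unit(5)]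
      _ _ _ _ _ _ _ _ _ _ _ _ par])
    show "\<nu>\<^sup>2 = 1 - \<mu>\<^sup>2" using \<mu> \<nu> by (simp add: field_simps)
    show "\<bar>\<nu> * f x $ 3\<bar> < 1 - \<mu> * f x $ 1" by (rule pole[OF unit(3) ne(1,2)])
    show "\<bar>\<nu> * f y $ 3\<bar> < 1 - \<mu> * f y $ 1" by (rule pole[OF unit(4) ne(3,4)])
    show "\<bar>\<nu> * f z $ 3\<bar> < 1 - \<mu> * f z $ 1" by (rule pole[OF unit(5) ne(5,6)])
  qed (use \<mu> \<mu>_le min lt in \<open>simp_all add: xyz[symmetric]\<close>)
  also have "\<dots> = set_energy {a, b, x, y, z}"
  proof -
    have "4 * (1 - \<mu>\<^sup>2) = 2 - 2 * (a \<bullet> b)" using \<mu> by simp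
    then show ?thesis
      unfolding set_energy_five[OF dist] using unit by (simp add: norm_diff_unit)
  qed
  finally show ?thesis using gt by linarith
qed

text \<open>A pair with the smallest inner product is selected. The energy is strictly above 17/4
  unless that inner product is -1, when the pair is antipodal and the equality case is
  known.\<close>

lemma set_energy_min:
  assumes "card P = 5" "P \<subseteq> S2"
  shows "17 / 4 \<le> set_energy P"
    and "set_energy P \<le> 17 / 4 \<Longrightarrow> triangular_bipyramid P"
proof -
  have fin: "finite P" using assms(1) by (simp add: card_ge_0_finite)
  define T where "T = {(x, y) \<in> P \<times> P. x \<noteq> y}"
  define g where "g = (\<lambda>(x, y). x \<bullet> y :: real) ` T"
  have "finite g" using fin by (auto simp: g_def T_def intro: finite_subset[of _ "P \<times> P"])
  have "2 \<le> card P" using assms(1) by simp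
  then have "g \<noteq> {}"
    by (auto simp: g_def T_def card_le_Suc_iff numeral_2_eq_2)
  then have "Min g \<in> g" using \<open>finite g\<close> by simp
  then obtain a b where ab: "a \<in> P" "b \<in> P" "a \<noteq> b" "a \<bullet> b = Min g"
    by (auto simp: g_def T_def)
  have min: "a \<bullet> b \<le> x \<bullet> y" if "x \<in> P" "y \<in> P" "x \<noteq> y" for x y
    using Min_le[OF \<open>finite g\<close>, of "x \<bullet> y"] that by (force simp: ab g_def T_def)
  have "card (P - {a, b}) = 3"
    using ab assms(1) fin by (simp add: card_Diff_subset)
  then obtain x y z where xyz: "P - {a, b} = {x, y, z}" "x \<noteq> y" "y \<noteq> z" "x \<noteq> z"
    by (auto simp: card_3_iff)
  have P: "P = {a, b, x, y, z}" using xyz ab by auto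
  have dist: "distinct [a, b, x, y, z]" using xyz ab by auto
  have unit: "norm a = 1" "norm b = 1" "norm x = 1" "norm y = 1" "norm z = 1"
    using assms(2) by (auto simp: P)
  have "17 / 4 < set_energy P \<or> b = - a"
  proof (cases "- 2 / 3 < a \<bullet> b")
    case True
    then show ?thesis
      using set_energy_gt_if_no_far_pair[OF assms min True] inner_unit_less_1[OF unit(1,2) ab(3)] by blast
  next
    case False
    show ?thesis
    proof (cases "a \<bullet> b = - 1")
      case True
      then have "norm (a + b) ^ 2 = 0"
        using unit by (simp add: power2_norm_eq_inner inner_add inner_commute norm_eq_1)
      then show ?thesis by (simp add: eq_neg_iff_add_eq_0 add.commute)
    next
      case F: False
      have "- 1 \<le> a \<bullet> b" using Cauchy_Schwarz_ineq2[of a b] unit by (simp add: abs_le_iff)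
      with F have "- 1 < a \<bullet> b" by simp
      then show ?thesis
        unfolding P using set_energy_gt_if_far_pair[OF unit dist] False min dist P by auto
    qed
  qed
  then have "17 / 4 \<le> set_energy P \<and> (set_energy P \<le> 17 / 4 \<longrightarrow> triangular_bipyramid P)"
    using antipodal_set_energy[OF unit(1,3,4,5)] dist by (auto simp: P)
  then show "17 / 4 \<le> set_energy P" "set_energy P \<le> 17 / 4 \<Longrightarrow> triangular_bipyramid P" by auto
qed

lemma configuration_card:
  assumes "configuration p"
  shows "card (points p) = 5" "points p \<subseteq> S2"
  using assms by (auto simp: configuration_def points_def card_image)

lemma configuration_energy:
  assumes "configuration p"
  shows "energy p = set_energy (points p)"
  using assms energy_eq_set_energy by (simp add: configuration_def)

lemma triangular_bipyramid_energy:
  assumes "triangular_bipyramid P"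
  shows "set_energy P = 17 / 4"
  using triangular_bipyramid_normal_form[OF assms] set_energy_orthogonal_image set_energy_standard by metis

lemma orthogonal_transformation_S2_isometry:
  assumes "orthogonal_transformation f"
  shows "S2_isometry f"
proof -
  have "f ` S2 = S2"
  proof (intro equalityI subsetI)
    fix x :: "real ^ 3" assume "x \<in> S2"
    moreover have "x = f (inv f x)"
      using orthogonal_transformation_surj[OF assms] by (simp add: surj_f_inv_f)
    ultimately show "x \<in> f ` S2"
      using orthogonal_transformation_norm[OF assms, of "inv f x"] by (auto intro!: image_eqI)
  qed (use orthogonal_transformation_norm[OF assms] in auto)
  then show ?thesis
    using assms orthogonal_transformation_inj[OF assms]
    by (auto simp: S2_isometry_def bij_betw_def orthogonal_transformation_isometry intro: inj_on_subset)
qed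

theorem theorem1p2:
  shows "(\<exists>t. configuration t \<and> triangular_bipyramid (points t)) \<and>
    (\<forall>t. configuration t \<and> triangular_bipyramid (points t) \<longrightarrow>
       energy_minimizer t \<and>
       (\<forall>p. energy_minimizer p \<longrightarrow> (\<exists>f. S2_isometry f \<and> points p = f ` points t)))"
proof (intro conjI allI impI)
  have "card standard_bipyramid = 5"
    using distinct_card[OF distinct_standard_bipyramid] by (simp add: standard_bipyramid_def)
  then obtain t :: "nat \<Rightarrow> real ^ 3" where t: "bij_betw t {1..5} standard_bipyramid"
    using ex_bij_betw_nat_finite_1[of standard_bipyramid] by (auto simp: card_ge_0_finite)
  then have "points t = standard_bipyramid" by (simp add: points_def bij_betw_def)
  moreover have "standard_bipyramid \<subseteq> S2"
    by (auto simp: standard_bipyramid_def norm_eq_1 inner_3 axis_3_component)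
  ultimately have "configuration t \<and> triangular_bipyramid (points t)"
    using t triangular_bipyramid_standard by (simp add: configuration_def bij_betw_def)
  then show "\<exists>t. configuration t \<and> triangular_bipyramid (points t)" by blast
next
  fix t assume t: "configuration t \<and> triangular_bipyramid (points t)"
  then have energy_t: "energy t = 17 / 4"
    by (simp add: configuration_energy triangular_bipyramid_energy)
  show "energy_minimizer t"
    using t set_energy_min(1)[OF configuration_card]
    by (simp add: energy_minimizer_def energy_t configuration_energy)
  fix p assume "energy_minimizer p"
  then have "configuration p" "energy p \<le> 17 / 4"
    using t energy_t by (auto simp: energy_minimizer_def)
  then have "triangular_bipyramid (points p)"
    using set_energy_min(2)[OF configuration_card] by (simp add: configuration_energy)
  then obtain g where g: "orthogonal_transformation g" "g ` points p = standard_bipyramid"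
    by (rule triangular_bipyramid_normal_form)
  obtain f where f: "orthogonal_transformation f" "f ` points t = standard_bipyramid"
    using t by (auto elim: triangular_bipyramid_normal_form)
  \<comment> \<open>Both bi-pyramids are carried to the standard one, so one map followed by the
    inverse of the other relates them.\<close>
  have "points p = (inv g \<circ> f) ` points t"
    using f g orthogonal_transformation_inj[OF g(1)] by (metis image_comp image_inv_f_f)
  moreover have "S2_isometry (inv g \<circ> f)"
    using f g by (intro orthogonal_transformation_S2_isometry orthogonal_transformation_compose
      orthogonal_transformation_inv)
  ultimately show "\<exists>f. S2_isometry f \<and> points p = f ` points t" by blast
qed

end
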